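(* Let $D=D_1\cup\cdots\cup D_n$ be a diagram of a chequerboard colourable oriented virtual link $L$, taken with a chequerboard colouring of its abstract link diagram $F_D$. Let $\mathscr{C}$ be the $2$-colouring of $D$ distinguished by this chequerboard colouring, and take $\mathscr{C}$ as the base $2$-colouring. Then, for all $i$ and all $i\neq j$ in $\{1,\ldots,n\}$, $$J_i(D)=lk(D_i,D),\qquad J_{i,j}(D)=lk(D_i\cup D_j,D),$$ where $D_i$ is the $i$-th component of $D$.
   Context: A virtual link diagram is a generic immersion of finitely many circles in the plane whose double points are marked either as classical crossings (with over/under information) or virtual crossings. A virtual link is an equivalence class of such diagrams under the virtual Reidemeister moves. Classical crossings of an oriented diagram have a sign $\pm1$ in the usual way. A mixed crossing is a classical crossing between two distinct components. Shadow: $S(D)$ is obtained from $D$ by forgetting the over/under decoration at classical crossings, which become flat crossings. The arcs of $S(D)$ run between flat crossings (passing straight through virtual crossings); a component without classical crossings is a single arc. A $2$-colouring $\mathscr{C}$ of $D$ is a colouring of the arcs of $S(D)$, each exactly one of red and green, such that on each of the two strands through a flat crossing the colour changes when passing straight through the crossing (so the four arc-ends are cyclically red, red, green, green). Dualizing on a component means interchanging red and green on that component; this yields another $2$-colouring. $2$-colour parity: for an oriented $D$ with $2$-colouring $\mathscr{C}$, a classical crossing $c$ has $\mathfrak{p}_{\mathscr{C}}(c)=0$ (even) if the two arcs oriented into $c$ have different colours, and $\mathfrak{p}_{\mathscr{C}}(c)=1$ (odd) if they have the same colour. Put $J_{\mathscr{C}}(D)=\sum_{\mathfrak{p}_{\mathscr{C}}(c)=1}\mathrm{sign}(c)$.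 With base $2$-colouring $\mathscr{C}$: $J_i(D)$ denotes $J_{\mathscr{C}'}(D)$ for $\mathscr{C}'$ obtained from $\mathscr{C}$ by dualizing on the $i$-th component, and $J_{i,j}(D)$ denotes $J_{\mathscr{C}''}(D)$ for $\mathscr{C}''$ obtained by dualizing on the $i$-th and $j$-th components. Chequerboard colourings: the abstract link diagram $F_D$ of $D$ is the pair of a compact surface with boundary and a link diagram on it, formed by placing a disc about each classical crossing, two separate discs at each virtual crossing (one around each of the two strands, so that the strands do not meet in the surface), and joining these discs by collars (bands) about the arcs of $D$; the surface is oriented by the plane. A chequerboard colouring of $F_D$ is a shading of some of the components of the complement of the underlying curves in the surface so that exactly one side of each arc is shaded; thus at each classical crossing the four regions are alternately shaded and unshaded. $F_D$ is chequerboard colourable if it has a chequerboard colouring, and a virtual link is chequerboard colourable if it has a diagram $D$ with $F_D$ chequerboard colourable. Distinguished $2$-colouring: give the shaded regions the clockwise orientation; colour an arc of $S(D)$ red if its orientation (from $D$) agrees with that induced by the orientation of the adjacent shaded region, and green otherwise. Equivalently, an arc is red if the shading is on its right and green if it is on its left. Linking numbers: $lk(D_i,D_j)$ is the sum of the signs of the mixed crossings between $D_i$ and $D_j$ (with no factor $\tfrac12$). Similarly $lk(D_i,D)$ is the sum of the signs of all mixed crossings between $D_i$ and the other components, and $lk(D_i\cup D_j,D)$ is the sum of the signs of all mixed crossings between $D_i\cup D_j$ and the components of $D$ other than $D_i$ and $D_j$. *)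

theory Defs
  imports "HOL-Analysis.Analysis"
begin

section \<open>Oriented virtual link diagrams\<close>

text \<open>
  The plane is the type of complex numbers. A diagram is an immersion of the disjoint union of
  the circles \<open>{i} \<times> sphere 0 1\<close>, \<open>i = 1, \<dots>, n\<close>; each circle is oriented counterclockwise, and
  this is the orientation of the diagram (precomposing with complex conjugation reverses it).
  A pair \<open>(i, z)\<close> is a point of the source, not of the plane. The set \<^term>\<open>classical\<close> consists
  of those double points that are marked as classical crossings; all other double points are
  virtual. For a classical crossing \<open>c\<close>, \<^term>\<open>over_strand\<close> gives the preimage of \<open>c\<close> that lies
  on the overcrossing strand.
\<close>

type_synonym source_point = "nat \<times> complex"

record diagram =
  ncomp :: nat
  curve :: "nat \<Rightarrow> complex \<Rightarrow> complex"
  classical :: "complex set"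
  over_strand :: "complex \<Rightarrow> source_point"

definition circles :: "diagram \<Rightarrow> source_point set" where
  "circles D = {1..ncomp D} \<times> sphere 0 1"

definition pt :: "diagram \<Rightarrow> source_point \<Rightarrow> complex" where
  "pt D x = curve D (fst x) (snd x)"

definition velocity :: "diagram \<Rightarrow> source_point \<Rightarrow> complex" where
  "velocity D x = vector_derivative (\<lambda>t. curve D (fst x) (snd x * cis t)) (at 0)"

definition preimages :: "diagram \<Rightarrow> complex \<Rightarrow> source_point set" where
  "preimages D p = {x \<in> circles D. pt D x = p}"

definition multiple_points :: "diagram \<Rightarrow> complex set" where
  "multiple_points D =
     {p. \<exists>x\<in>preimages D p. \<exists>y\<in>preimages D p. x \<noteq> y}"

text \<open>\<open>det2 u v > 0\<close> means that \<open>v\<close> points to the left of \<open>u\<close>.\<close>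

definition det2 :: "complex \<Rightarrow> complex \<Rightarrow> real" where
  "det2 u v = Re u * Im v - Im u * Re v"

definition immersion :: "diagram \<Rightarrow> bool" where
  "immersion D \<longleftrightarrow>
     (\<forall>i\<in>{1..ncomp D}. (\<lambda>t. curve D i (cis t)) C1_differentiable_on UNIV) \<and>
     (\<forall>x\<in>circles D. velocity D x \<noteq> 0)"

definition generic :: "diagram \<Rightarrow> bool" where
  "generic D \<longleftrightarrow>
     finite (multiple_points D) \<and>
     (\<forall>p\<in>multiple_points D. card (preimages D p) = 2 \<and>
        (\<forall>x\<in>preimages D p. \<forall>y\<in>preimages D p. x \<noteq> y \<longrightarrow>
           det2 (velocity D x) (velocity D y) \<noteq> 0))"

definition virtual_link_diagram :: "diagram \<Rightarrow> bool" where
  "virtual_link_diagram D \<longleftrightarrow>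
     immersion D \<and> generic D \<and> classical D \<subseteq> multiple_points D \<and>
     (\<forall>c\<in>classical D. over_strand D c \<in> preimages D c)"

definition under_strand :: "diagram \<Rightarrow> complex \<Rightarrow> source_point" where
  "under_strand D c = (THE x. x \<in> preimages D c \<and> x \<noteq> over_strand D c)"

text \<open>A crossing is positive if the overcrossing direction is turned to the undercrossing
  direction by a counterclockwise rotation through less than half a turn.\<close>

definition crossing_sign :: "diagram \<Rightarrow> complex \<Rightarrow> int" where
  "crossing_sign D c =
     (if det2 (velocity D (over_strand D c)) (velocity D (under_strand D c)) > 0
      then 1 else -1)"

section \<open>Linking numbers\<close>

definition mixed :: "diagram \<Rightarrow> complex \<Rightarrow> bool" where
  "mixed D c \<longleftrightarrow> fst (over_strand D c) \<noteq> fst (under_strand D c)"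

text \<open>The linking number of two disjoint sublinks, given by their sets of component indices;
  there is no factor one half.\<close>

definition lk :: "diagram \<Rightarrow> nat set \<Rightarrow> nat set \<Rightarrow> int" where
  "lk D I J =
     (\<Sum>c \<in> {c \<in> classical D. mixed D c \<and>
              (fst (over_strand D c) \<in> I \<and> fst (under_strand D c) \<in> J \<or>
               fst (over_strand D c) \<in> J \<and> fst (under_strand D c) \<in> I)}.
        crossing_sign D c)"

text \<open>\<open>lk(D\<^sub>i, D)\<close> is \<open>lk_rest D {i}\<close>, and \<open>lk(D\<^sub>i \<union> D\<^sub>j, D)\<close> is \<open>lk_rest D {i, j}\<close>.\<close>

definition lk_rest :: "diagram \<Rightarrow> nat set \<Rightarrow> int" where
  "lk_rest D I = lk D I ({1..ncomp D} - I)"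

section \<open>Arcs of the shadow and 2-colourings\<close>

text \<open>An arc is represented by the index of its component and a subset of the source circle.
  Only preimages of classical crossings cut the circle, so arcs pass through virtual crossings,
  and a circle without classical crossings is one arc.\<close>

type_synonym arc = "nat \<times> complex set"

definition arcs :: "diagram \<Rightarrow> arc set" where
  "arcs D = (SIGMA i:{1..ncomp D}.
               components (sphere 0 1 - {z. curve D i z \<in> classical D}))"

text \<open>At a source point \<open>x\<close> over a classical crossing there are two arc-ends: the one along
  which the strand runs into the crossing, and the one along which it runs out.\<close>

datatype direction = Incoming | Outgoing

type_synonym arc_end = "source_point \<times> direction"

fun end_filter :: "direction \<Rightarrow> real filter" where
  "end_filter Incoming = at_left 0"
| "end_filter Outgoing = at_right 0"

definition arc_at :: "diagram \<Rightarrow> arc_end \<Rightarrow> arc" where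
  "arc_at D e = (THE a. a \<in> arcs D \<and> fst a = fst (fst e) \<and>
     (\<forall>\<^sub>F t in end_filter (snd e). snd (fst e) * cis t \<in> snd a))"

datatype colour = Red | Green

fun opposite :: "colour \<Rightarrow> colour" where
  "opposite Red = Green"
| "opposite Green = Red"

type_synonym colouring = "arc \<Rightarrow> colour"

definition two_colouring :: "diagram \<Rightarrow> colouring \<Rightarrow> bool" where
  "two_colouring D C \<longleftrightarrow>
     (\<forall>c\<in>classical D. \<forall>x\<in>preimages D c.
        C (arc_at D (x, Incoming)) \<noteq> C (arc_at D (x, Outgoing)))"

definition dualize :: "nat \<Rightarrow> colouring \<Rightarrow> colouring" where
  "dualize i C = (\<lambda>a. if fst a = i then opposite (C a) else C a)"

definition parity :: "diagram \<Rightarrow> colouring \<Rightarrow> complex \<Rightarrow> nat" where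
  "parity D C c =
     (if C (arc_at D (over_strand D c, Incoming)) \<noteq> C (arc_at D (under_strand D c, Incoming))
      then 0 else 1)"

definition J_invariant :: "diagram \<Rightarrow> colouring \<Rightarrow> int" where
  "J_invariant D C = (\<Sum>c \<in> {c \<in> classical D. parity D C c = 1}. crossing_sign D c)"

section \<open>The abstract link diagram and its chequerboard colourings\<close>

text \<open>
  Removing the curves from the surface of the abstract link diagram cuts the band along each arc
  into a left and a right half-band (this includes the annulus about a crossingless component, and
  the two separate discs at a virtual crossing, which merely continue the bands), and cuts the disc
  about each classical crossing into four quadrants. A quadrant lies between two arc-ends that are
  consecutive in counterclockwise order and is glued to exactly one half-band of each. Every piece
  is connected, so the components of the complement correspond to the classes of half-bands under
  the equivalence relation generated by meeting a common quadrant.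
\<close>

datatype side = LeftSide | RightSide

type_synonym half_band = "arc \<times> side"

fun other_side :: "side \<Rightarrow> side" where
  "other_side LeftSide = RightSide"
| "other_side RightSide = LeftSide"

text \<open>The direction in which an arc-end leaves the crossing.\<close>

fun end_direction :: "diagram \<Rightarrow> arc_end \<Rightarrow> complex" where
  "end_direction D (x, Incoming) = - velocity D x"
| "end_direction D (x, Outgoing) = velocity D x"

text \<open>Seen from the crossing, the counterclockwise side of an arc-end is on the left. For an
  incoming end this is the right-hand side with respect to the orientation of the arc.\<close>

fun ccw_side :: "direction \<Rightarrow> side" where
  "ccw_side Incoming = RightSide"
| "ccw_side Outgoing = LeftSide"

definition ccw_half_band :: "diagram \<Rightarrow> arc_end \<Rightarrow> half_band" where
  "ccw_half_band D e = (arc_at D e, ccw_side (snd e))"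

definition cw_half_band :: "diagram \<Rightarrow> arc_end \<Rightarrow> half_band" where
  "cw_half_band D e = (arc_at D e, other_side (ccw_side (snd e)))"

text \<open>The quadrants, each given by the two arc-ends bounding it. As the two strands cross
  transversally, the arc-end following \<open>e\<close> in counterclockwise order is the one end \<open>e'\<close> of the
  other strand whose direction is on the left of that of \<open>e\<close>.\<close>

definition quadrants :: "diagram \<Rightarrow> (arc_end \<times> arc_end) set" where
  "quadrants D = {(e, e'). \<exists>c\<in>classical D.
     fst e \<in> preimages D c \<and> fst e' \<in> preimages D c \<and> fst e \<noteq> fst e' \<and>
     det2 (end_direction D e) (end_direction D e') > 0}"

definition half_bands :: "diagram \<Rightarrow> half_band set" where
  "half_bands D = arcs D \<times> UNIV"

definition glued :: "diagram \<Rightarrow> half_band rel" where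
  "glued D = (\<lambda>(e, e'). (ccw_half_band D e, cw_half_band D e')) ` quadrants D"

definition same_region :: "diagram \<Rightarrow> half_band rel" where
  "same_region D = (glued D \<union> (glued D)\<inverse>)\<^sup>*"

definition regions :: "diagram \<Rightarrow> half_band set set" where
  "regions D = half_bands D // same_region D"

definition region_at :: "diagram \<Rightarrow> arc \<Rightarrow> side \<Rightarrow> half_band set" where
  "region_at D a s = same_region D `` {(a, s)}"

text \<open>A chequerboard colouring is given by its set of shaded regions.\<close>

definition chequerboard_colouring :: "diagram \<Rightarrow> half_band set set \<Rightarrow> bool" where
  "chequerboard_colouring D S \<longleftrightarrow>
     S \<subseteq> regions D \<and>
     (\<forall>a\<in>arcs D. (region_at D a LeftSide \<in> S) \<noteq> (region_at D a RightSide \<in> S))"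

text \<open>The boundary of a shaded region with its clockwise orientation has the region on its right,
  so the two orientations of an arc agree precisely if the shading is on the right of the arc.\<close>

definition distinguished :: "diagram \<Rightarrow> half_band set set \<Rightarrow> colouring" where
  "distinguished D S = (\<lambda>a. if region_at D a RightSide \<in> S then Red else Green)"

section \<open>The definitions are consistent\<close>

text \<open>\<^const>\<open>arc_at\<close> is well defined, a distinguished colouring is a 2-colouring, and dualizing
  preserves 2-colourings.\<close>

lemma finite_cut_points:
  assumes "virtual_link_diagram D" "i \<in> {1..ncomp D}"
  shows "finite {z \<in> sphere 0 1. curve D i z \<in> classical D}"
proof -
  have fin: "finite (preimages D c)" if "c \<in> classical D" for c
  proof -
    have "card (preimages D c) = 2"
      using assms that by (auto simp: virtual_link_diagram_def generic_def)
    then show ?thesis by (metis card.infinite zero_neq_numeral)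
  qed
  have "finite (classical D)"
    using assms finite_subset by (auto simp: virtual_link_diagram_def generic_def)
  then have "finite (snd ` (\<Union>c\<in>classical D. preimages D c))" using fin by blast
  moreover have "{z \<in> sphere 0 1. curve D i z \<in> classical D}
      \<subseteq> snd ` (\<Union>c\<in>classical D. preimages D c)"
  proof
    fix z assume "z \<in> {z \<in> sphere 0 1. curve D i z \<in> classical D}"
    then have "(i, z) \<in> preimages D (curve D i z)" "curve D i z \<in> classical D"
      using assms(2) by (auto simp: preimages_def circles_def pt_def)
    then show "z \<in> snd ` (\<Union>c\<in>classical D. preimages D c)" by force
  qed
  ultimately show ?thesis by (rule finite_subset[rotated])
qed

lemma eventually_mult_cis_ne:
  fixes z w :: complex
  assumes "z \<in> sphere 0 1"
  shows "\<forall>\<^sub>F t in at 0. z * cis t \<noteq> w"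
proof (cases "w = z")
  case True
  have "\<forall>\<^sub>F t in at (0::real). t \<in> {-1<..<1} - {0}"
    by (intro eventually_at_in_open) auto
  then show ?thesis
  proof eventually_elim
    case (elim t)
    have "sin t \<noteq> 0"
    proof
      assume "sin t = 0"
      then obtain k :: int where k: "t = of_int k * pi" using sin_zero_iff_int2 by blast
      then have "k \<noteq> 0" using elim by auto
      then have "1 \<le> \<bar>real_of_int k\<bar>" by linarith
      then have "pi \<le> \<bar>t\<bar>" using k by (simp add: abs_mult)
      then show False using elim pi_gt3 by auto
    qed
    then have "cis t \<noteq> 1" by (auto simp: complex_eq_iff)
    moreover have "z \<noteq> 0" using assms by auto
    ultimately show ?case using True by auto
  qed
next
  case False
  have "((\<lambda>t. z * cis t) \<longlongrightarrow> z * cis 0) (at 0)"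
    by (intro tendsto_intros isCont_tendsto_compose[of 0 cis])
  then show ?thesis using False by (intro tendsto_imp_eventually_ne) auto
qed

lemma arc_at_exists:
  assumes D: "virtual_link_diagram D" and x: "x \<in> circles D"
  shows "\<exists>!a. a \<in> arcs D \<and> fst a = fst x \<and> (\<forall>\<^sub>F t in end_filter d. snd x * cis t \<in> snd a)"
proof -
  obtain i z where xz: "x = (i, z)" by fastforce
  have i: "i \<in> {1..ncomp D}" and z: "z \<in> sphere 0 1" using x xz by (auto simp: circles_def)
  define U where "U = sphere 0 1 - {z. curve D i z \<in> classical D}"
  define F where "F = end_filter d"
  have F: "F = at_left 0 \<or> F = at_right 0" unfolding F_def by (cases d) auto
  have ntriv: "F \<noteq> bot"
    using F trivial_limit_at_left_real[of 0] trivial_limit_at_right_real[of 0] by metis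
  have sph: "z * cis t \<in> sphere 0 1" for t using z by (simp add: norm_mult)
  have "\<forall>\<^sub>F t in at 0. \<forall>w\<in>{z \<in> sphere 0 1. curve D i z \<in> classical D}. z * cis t \<noteq> w"
    by (intro eventually_ball_finite finite_cut_points D i ballI eventually_mult_cis_ne z)
  then have "\<forall>\<^sub>F t in at 0. z * cis t \<in> U"
    by eventually_elim (use sph in \<open>auto simp: U_def\<close>)
  then have ev: "\<forall>\<^sub>F t in F. z * cis t \<in> U"
    using F eventually_at_split by blast
  obtain I where I: "connected I" "I \<noteq> {}" "\<forall>\<^sub>F t in F. t \<in> I" "\<And>t. t \<in> I \<Longrightarrow> z * cis t \<in> U"
  proof (cases "F = at_left 0")
    case True
    then obtain b where "b < 0" "\<forall>t>b. t < 0 \<longrightarrow> z * cis t \<in> U"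
      using ev eventually_at_left[of "-1" "0::real"] by auto
    then show thesis
      using True by (intro that[of "{b<..<0}"]) (auto intro: eventually_at_leftI[of b])
  next
    case False
    then have R: "F = at_right 0" using F by auto
    then obtain b where "b > 0" "\<forall>t>0. t < b \<longrightarrow> z * cis t \<in> U"
      using ev eventually_at_right[of "0::real" 1] by auto
    then show thesis
      using R by (intro that[of "{0<..<b}"]) (auto intro: eventually_at_rightI[of _ b])
  qed
  have "connected ((\<lambda>t. z * cis t) ` I)"
    by (intro connected_continuous_image I continuous_intros)
  moreover have "(\<lambda>t. z * cis t) ` I \<subseteq> U" "(\<lambda>t. z * cis t) ` I \<noteq> {}" using I by auto
  ultimately obtain A where A: "A \<in> components U" "(\<lambda>t. z * cis t) ` I \<subseteq> A"
    using exists_component_superset[of "(\<lambda>t. z * cis t) ` I" U] by (cases "U = {}") auto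
  show ?thesis
  proof (rule ex1I)
    show "(i, A) \<in> arcs D \<and> fst (i, A) = fst x \<and>
        (\<forall>\<^sub>F t in end_filter d. snd x * cis t \<in> snd (i, A))"
      using i A I(3) xz by (auto simp: arcs_def U_def F_def elim!: eventually_mono)
  next
    fix a assume a: "a \<in> arcs D \<and> fst a = fst x \<and> (\<forall>\<^sub>F t in end_filter d. snd x * cis t \<in> snd a)"
    then have "\<forall>\<^sub>F t in F. z * cis t \<in> snd a \<and> t \<in> I"
      using I(3) xz by (auto simp: F_def intro: eventually_conj)
    then obtain t where "z * cis t \<in> snd a" "t \<in> I"
      using eventually_happens'[OF ntriv] by blast
    moreover have "snd a \<in> components U" using a xz by (auto simp: arcs_def U_def)
    ultimately have "snd a = A" using A components_nonoverlap[of "snd a" U A] by auto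
    then show "a = (i, A)" using a xz by (cases a) auto
  qed
qed

lemma arc_at:
  assumes "virtual_link_diagram D" "x \<in> circles D"
  shows "arc_at D (x, d) \<in> arcs D" "fst (arc_at D (x, d)) = fst x"
    "\<forall>\<^sub>F t in end_filter d. snd x * cis t \<in> snd (arc_at D (x, d))"
  using theI'[OF arc_at_exists[OF assms, of d]] by (auto simp: arc_at_def)

lemma region_at_glued:
  assumes "(e, e') \<in> quadrants D"
  shows "region_at D (arc_at D e) (ccw_side (snd e)) =
    region_at D (arc_at D e') (other_side (ccw_side (snd e')))"
proof -
  have "((arc_at D e, ccw_side (snd e)), (arc_at D e', other_side (ccw_side (snd e')))) \<in> glued D"
    using assms by (force simp: glued_def ccw_half_band_def cw_half_band_def)
  moreover have "equiv UNIV (same_region D)"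
    unfolding same_region_def
    by (auto intro!: equivI refl_rtrancl trans_rtrancl sym_rtrancl simp: sym_Un_converse)
  ultimately show ?thesis
    unfolding region_at_def by (intro equiv_class_eq) (auto simp: same_region_def)
qed

lemma two_colouring_distinguished:
  assumes D: "virtual_link_diagram D" and S: "chequerboard_colouring D S"
  shows "two_colouring D (distinguished D S)"
  unfolding two_colouring_def
proof (intro ballI)
  fix c x assume c: "c \<in> classical D" and x: "x \<in> preimages D c"
  have mp: "c \<in> multiple_points D" using c D by (auto simp: virtual_link_diagram_def)
  then obtain y where y: "y \<in> preimages D c" "x \<noteq> y"
    unfolding multiple_points_def by auto
  have nz: "det2 (velocity D x) (velocity D y) \<noteq> 0"
    using D mp x y by (auto simp: virtual_link_diagram_def generic_def)
  have circ: "x \<in> circles D" "y \<in> circles D" using x y by (auto simp: preimages_def)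
  note ch = S[unfolded chequerboard_colouring_def, THEN conjunct2, rule_format]
  note chs = ch[OF arc_at(1)[OF D circ(1)], of Incoming] ch[OF arc_at(1)[OF D circ(1)], of Outgoing]
    ch[OF arc_at(1)[OF D circ(2)], of Incoming]
  show "distinguished D S (arc_at D (x, Incoming)) \<noteq> distinguished D S (arc_at D (x, Outgoing))"
  proof (cases "det2 (velocity D x) (velocity D y) > 0")
    case True
    then have "((x, Incoming), (y, Incoming)) \<in> quadrants D"
      "((y, Incoming), (x, Outgoing)) \<in> quadrants D"
      using c x y by (auto simp: quadrants_def det2_def algebra_simps)
    from this[THEN region_at_glued] chs show ?thesis by (auto simp: distinguished_def)
  next
    case False
    then have "((y, Incoming), (x, Incoming)) \<in> quadrants D"
      "((x, Outgoing), (y, Incoming)) \<in> quadrants D"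
      using c x y nz by (auto simp: quadrants_def det2_def algebra_simps)
    from this[THEN region_at_glued] chs show ?thesis by (auto simp: distinguished_def)
  qed
qed

lemma two_colouring_dualize:
  assumes "virtual_link_diagram D" "two_colouring D C"
  shows "two_colouring D (dualize i C)"
  unfolding two_colouring_def
proof (intro ballI)
  fix c x assume c: "c \<in> classical D" and x: "x \<in> preimages D c"
  have circ: "x \<in> circles D" using x by (auto simp: preimages_def)
  have "C (arc_at D (x, Incoming)) \<noteq> C (arc_at D (x, Outgoing))"
    using assms(2) c x by (auto simp: two_colouring_def)
  then show "dualize i C (arc_at D (x, Incoming)) \<noteq> dualize i C (arc_at D (x, Outgoing))"
    using arc_at(2)[OF assms(1) circ]
    by (cases "C (arc_at D (x, Incoming))"; cases "C (arc_at D (x, Outgoing))")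
      (auto simp: dualize_def)
qed

end

theory Submission
  imports Defs
begin

text \<open>
  At every classical crossing of a chequerboard coloured diagram, the region between the two incoming
  arc-ends lies to the right of one and to the left of the other, so these ends have different
  colours and every crossing is even. Dualizing on a set of components makes odd exactly those
  crossings with precisely one strand in that set.
\<close>

text \<open>A classical crossing has exactly two preimages, so the definite description in
  \<open>under_strand_def\<close> denotes the one off the overcrossing strand.\<close>

lemma under_strand:
  assumes D: "virtual_link_diagram D" and c: "c \<in> classical D"
  shows "under_strand D c \<in> preimages D c" "under_strand D c \<noteq> over_strand D c"
proof -
  have "card (preimages D c) = 2" "over_strand D c \<in> preimages D c"
    using D c by (auto simp: virtual_link_diagram_def generic_def)
  then have "\<exists>!x. x \<in> preimages D c \<and> x \<noteq> over_strand D c"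
    by (metis card_2_iff')
  from theI'[OF this] show "under_strand D c \<in> preimages D c" "under_strand D c \<noteq> over_strand D c"
    by (auto simp: under_strand_def)
qed

lemma distinguished_incoming_neq:
  assumes D: "virtual_link_diagram D" and S: "chequerboard_colouring D S"
    and c: "c \<in> classical D" and x: "x \<in> preimages D c" and y: "y \<in> preimages D c" and "x \<noteq> y"
  shows "distinguished D S (arc_at D (x, Incoming)) \<noteq> distinguished D S (arc_at D (y, Incoming))"
proof -
  have nz: "det2 (velocity D x) (velocity D y) \<noteq> 0"
    using D c x y \<open>x \<noteq> y\<close> by (auto simp: virtual_link_diagram_def generic_def)
  have circ: "x \<in> circles D" "y \<in> circles D" using x y by (auto simp: preimages_def)
  note ch = S[unfolded chequerboard_colouring_def, THEN conjunct2, rule_format]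
  note chs = ch[OF arc_at(1)[OF D circ(1)], of Incoming] ch[OF arc_at(1)[OF D circ(2)], of Incoming]
  \<comment> \<open>Incoming ends point against the velocities; the two minus signs cancel in
    \<open>det2\<close>, so the sign of \<open>det2\<close> on the velocities decides which end
    comes first counterclockwise.\<close>
  consider "((x, Incoming), (y, Incoming)) \<in> quadrants D"
    | "((y, Incoming), (x, Incoming)) \<in> quadrants D"
    using c x y \<open>x \<noteq> y\<close> nz
    by (cases "det2 (velocity D x) (velocity D y) > 0")
      (auto simp: quadrants_def det2_def algebra_simps)
  \<comment> \<open>The common quadrant glues the right side of the first end to the left side of
    the second. Exactly one side of each arc is shaded, so exactly one of the two ends is
    red.\<close>
  then show ?thesis
    using chs by cases (auto dest!: region_at_glued simp: distinguished_def)
qed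

text \<open>Allowing an arbitrary set \<open>I\<close> of components covers both formulas at once,
  with \<open>{i}\<close> and \<open>{i, j}\<close> as instances.\<close>

lemma J_invariant_dualized:
  assumes D: "virtual_link_diagram D" and S: "chequerboard_colouring D S"
  shows "J_invariant D (\<lambda>a. if fst a \<in> I then opposite (distinguished D S a)
      else distinguished D S a) = lk_rest D I"
    (is "J_invariant D ?C = _")
proof -
  have "parity D ?C c = 1 \<longleftrightarrow> mixed D c \<and>
      (fst (over_strand D c) \<in> I \<and> fst (under_strand D c) \<in> {1..ncomp D} - I \<or>
       fst (over_strand D c) \<in> {1..ncomp D} - I \<and> fst (under_strand D c) \<in> I)"
    if c: "c \<in> classical D" for c
  proof -
    let ?x = "over_strand D c" and ?y = "under_strand D c"
    have x: "?x \<in> preimages D c" using D c by (auto simp: virtual_link_diagram_def)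
    note y = under_strand[OF D c]
    have circ: "?x \<in> circles D" "?y \<in> circles D" using x y by (auto simp: preimages_def)
    then have n: "fst ?x \<in> {1..ncomp D}" "fst ?y \<in> {1..ncomp D}" by (auto simp: circles_def)
    have "distinguished D S (arc_at D (?x, Incoming)) \<noteq> distinguished D S (arc_at D (?y, Incoming))"
      using distinguished_incoming_neq[OF D S c x y(1)] y(2) by metis
    \<comment> \<open>With only two colours, swapping one of two different colours makes them equal,
      while swapping both or neither keeps them different.\<close>
    then have "parity D ?C c = 1 \<longleftrightarrow> (fst ?x \<in> I) \<noteq> (fst ?y \<in> I)"
      using arc_at(2)[OF D circ(1)] arc_at(2)[OF D circ(2)]
      by (cases "distinguished D S (arc_at D (?x, Incoming))";
          cases "distinguished D S (arc_at D (?y, Incoming))") (auto simp: parity_def)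
    \<comment> \<open>If exactly one strand lies in \<open>I\<close>, the strands belong to
      different components, so the crossing is mixed.\<close>
    then show ?thesis using n by (auto simp: mixed_def simp del: atLeastAtMost_iff)
  qed
  then show ?thesis
    unfolding J_invariant_def lk_rest_def lk_def by (intro sum.cong) auto
qed

theorem proposition3p15:
  fixes D :: diagram and S :: "half_band set set"
  assumes "virtual_link_diagram D"
    and "chequerboard_colouring D S"
  shows "(\<forall>i\<in>{1..ncomp D}.
            J_invariant D (dualize i (distinguished D S)) = lk_rest D {i}) \<and>
         (\<forall>i\<in>{1..ncomp D}. \<forall>j\<in>{1..ncomp D}. i \<noteq> j \<longrightarrow>
            J_invariant D (dualize j (dualize i (distinguished D S))) = lk_rest D {i, j})"
proof -
  let ?C = "distinguished D S"
  have "dualize i ?C = (\<lambda>a. if fst a \<in> {i} then opposite (?C a) else ?C a)" for i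
    by (auto simp: dualize_def)
  then have "J_invariant D (dualize i ?C) = lk_rest D {i}" for i
    by (simp only: J_invariant_dualized[OF assms])
  \<comment> \<open>Distinctness matters: dualizing twice on one component would cancel, whereas
    membership in \<open>{i, j}\<close> swaps the colours once.\<close>
  moreover have two: "dualize j (dualize i ?C) = (\<lambda>a. if fst a \<in> {i, j} then opposite (?C a) else ?C a)"
    if "i \<noteq> j" for i j
    using that by (auto simp: dualize_def)
  moreover have "J_invariant D (dualize j (dualize i ?C)) = lk_rest D {i, j}" if "i \<noteq> j" for i j
    by (simp only: two[OF that] J_invariant_dualized[OF assms])
  ultimately show ?thesis by blast
qed

end
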